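(* Let $a,c\in\mathbb C\setminus\mathbb Z$ with $a-c\notin\mathbb Z\setminus\{0\}$. The infinite matrices $F=(f_{nk})_{n,k\in\mathbb Z}$ and $G=(g_{kl})_{k,l\in\mathbb Z}$ are inverses of each other, where $$f_{nk}=\frac{\Gamma(1+a-c)}{\Gamma(1+a+n+k)\,\Gamma(1-c-n-k)}$$ and $$g_{kl}=\frac{\Gamma(1+c-a)}{\Gamma(1+c+l+k)\,\Gamma(1-a-l-k)} .$$
   Context: Infinite matrices $F=(f_{nk})_{n,k\in\mathbb Z}$ and $G=(g_{kl})_{k,l\in\mathbb Z}$ with complex entries are called inverses of each other if and only if both $$\sum_{k\in\mathbb Z}f_{nk}g_{kl}=\delta_{nl}\quad\text{and}\quad\sum_{k\in\mathbb Z}g_{nk}f_{kl}=\delta_{nl}\qquad\text{for all }n,l\in\mathbb Z,$$ where all the sums are required to converge absolutely. (The matrices need not be triangular.) $\Gamma$ is the Gamma function, with $1/\Gamma$ entire. *)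

theory Defs
  imports "HOL-Analysis.Analysis"
begin

text \<open>Matrices indexed by the integers are functions \<open>int \<Rightarrow> int \<Rightarrow> complex\<close>, first argument the
  row and second the column; \<open>infsum\<close> is \<open>0\<close> on divergent families, so absolute convergence is
  required explicitly.\<close>

definition has_matrix_product ::
  "(int \<Rightarrow> int \<Rightarrow> complex) \<Rightarrow> (int \<Rightarrow> int \<Rightarrow> complex) \<Rightarrow> (int \<Rightarrow> int \<Rightarrow> complex) \<Rightarrow> bool" where
  "has_matrix_product F G H \<longleftrightarrow>
     (\<forall>n l. (\<lambda>k. norm (F n k * G k l)) summable_on UNIV \<and> (\<Sum>\<^sub>\<infinity>k. F n k * G k l) = H n l)"

definition inverse_matrices ::
  "(int \<Rightarrow> int \<Rightarrow> complex) \<Rightarrow> (int \<Rightarrow> int \<Rightarrow> complex) \<Rightarrow> bool" where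
  "inverse_matrices F G \<longleftrightarrow>
     has_matrix_product F G (\<lambda>n l. if n = l then 1 else 0) \<and>
     has_matrix_product G F (\<lambda>n l. if n = l then 1 else 0)"

end

theory Submission
  imports Defs
begin

text \<open>
  The product of the two matrices is a bilateral sum over the integers of a product of four
  reciprocal Gamma functions. By the reflection formula its summand is a constant multiple of a
  rational function of the summation index. With \<open>x = a + l + k\<close>, \<open>y = c + l + k\<close> and
  \<open>n - l = m + 1 > 0\<close> this function is \<open>(y + 1) \<dots> (y + m) / (x (x + 1) \<dots> (x + m + 1))\<close>, and it is the
  forward difference of \<open>y \<dots> (y + m) / (x \<dots> (x + m)) / ((m + 1) (a - c))\<close>, which has the same limit
  at both ends, so the sum vanishes. (For \<open>a = c\<close> the average of \<open>-1 / (x + j)\<close> over \<open>j \<le> m\<close> takes its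
  place.) The case \<open>n < l\<close> follows by exchanging \<open>a\<close> with \<open>c\<close>. For \<open>n = l\<close> the function is
  \<open>1 / (x y)\<close>, whose sum comes from the partial fractions of the cotangent, or of its derivative if
  \<open>a = c\<close>.
\<close>

section \<open>Limits along the integers\<close>

text \<open>Only finitely many integers lie in any disc. The filter \<open>cofinite\<close> treats
  both ends of the integers at once, which is what bilateral sums require.\<close>

lemma filterlim_of_int_at_infinity_cofinite:
  "filterlim (of_int :: int \<Rightarrow> complex) at_infinity cofinite"
  unfolding filterlim_at_infinity[OF order_refl]
proof safe
  fix r :: real
  have "{k :: int. \<not> r \<le> norm (of_int k :: complex)} \<subseteq> {- \<lceil>r\<rceil>..\<lceil>r\<rceil>}"
    by (auto simp: abs_if split: if_splits; linarith)
  thus "\<forall>\<^sub>F k :: int in cofinite. r \<le> norm (of_int k :: complex)"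
    unfolding eventually_cofinite by (rule finite_subset) simp
qed

lemma tendsto_inverse_shift_cofinite:
  "((\<lambda>k::int. 1 / (z + of_int k)) \<longlongrightarrow> (0::complex)) cofinite"
  by (intro tendsto_divide_0[OF tendsto_const] tendsto_add_filterlim_at_infinity[OF tendsto_const]
        filterlim_of_int_at_infinity_cofinite)

lemma add_of_int_nonzero:
  assumes "z \<notin> \<int>"
  shows "z + of_int k \<noteq> (0::complex)"
proof
  assume "z + of_int k = 0"
  hence "z = of_int (-k)" by (simp add: add_eq_0_iff2)
  with assms show False by simp
qed

lemma tendsto_ratio_cofinite:
  fixes z w :: complex
  assumes "z \<notin> \<int>"
  shows "((\<lambda>k::int. (w + of_int k) / (z + of_int k)) \<longlongrightarrow> 1) cofinite"
proof -
  have "((\<lambda>k::int. 1 + (w - z) * (1 / (z + of_int k))) \<longlongrightarrow> 1 + (w - z) * 0) cofinite"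
    by (intro tendsto_intros tendsto_inverse_shift_cofinite)
  moreover have "1 + (w - z) * (1 / (z + of_int k)) = (w + of_int k) / (z + of_int k)" for k
    using add_of_int_nonzero[OF assms, of k] by (simp add: field_simps)
  ultimately show ?thesis by simp
qed

section \<open>Convergence and evaluation of bilateral sums\<close>

lemma summable_on_int_inverse_squares:
  "(\<lambda>k::int. 1 / (of_int k)\<^sup>2 :: real) summable_on UNIV"
proof -
  have nat: "(\<lambda>n::nat. 1 / (of_nat n)\<^sup>2 :: real) summable_on UNIV"
    using inverse_power_summable[of 2, where 'a = real]
    by (intro norm_summable_imp_summable_on) (simp add: divide_inverse)
  have "range int \<union> range (\<lambda>n. - int n) = UNIV"
    by (metis (no_types, lifting) UNIV_eq_I UnI1 UnI2 int_cases2 rangeI)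
  moreover have "(\<lambda>k::int. 1 / (of_int k)\<^sup>2 :: real) summable_on range int"
    using nat by (subst summable_on_reindex) (auto simp: o_def inj_on_def)
  moreover have "(\<lambda>k::int. 1 / (of_int k)\<^sup>2 :: real) summable_on range (\<lambda>n. - int n)"
    using nat by (subst summable_on_reindex) (auto simp: o_def inj_on_def)
  ultimately show ?thesis
    using summable_on_union by metis
qed

text \<open>Outside a finite set \<open>B\<close> the terms are dominated by
  \<open>(norm L + 1) / k^2\<close>, and a finite set does not affect summability.\<close>

lemma abs_summable_on_int_quadratic_decay:
  fixes f :: "int \<Rightarrow> complex"
  assumes "((\<lambda>k. (of_int k)\<^sup>2 * f k) \<longlongrightarrow> L) cofinite"
  shows "(\<lambda>k. norm (f k)) summable_on UNIV"
proof -
  have "\<forall>\<^sub>F k in cofinite. dist ((of_int k)\<^sup>2 * f k) L < 1"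
    using assms by (rule tendstoD) simp
  moreover have "\<forall>\<^sub>F k::int in cofinite. k \<noteq> 0"
    by (simp add: eventually_cofinite)
  ultimately have "\<forall>\<^sub>F k in cofinite. norm (f k) \<le> (norm L + 1) * (1 / (of_int k)\<^sup>2)"
  proof eventually_elim
    case (elim k)
    have "norm ((of_int k)\<^sup>2 * f k) \<le> norm L + 1"
      using elim(1) norm_triangle_sub[of "(of_int k)\<^sup>2 * f k" L] by (simp add: dist_norm)
    thus ?case
      using elim(2) by (simp add: norm_mult norm_power field_simps)
  qed
  then obtain B where B: "finite B" "\<And>k. k \<notin> B \<Longrightarrow> norm (f k) \<le> (norm L + 1) * (1 / (of_int k)\<^sup>2)"
    unfolding eventually_cofinite by auto
  have "(\<lambda>k::int. (norm L + 1) * (1 / (of_int k)\<^sup>2)) summable_on - B"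
    by (intro summable_on_cmult_right summable_on_subset_banach[OF summable_on_int_inverse_squares])
       auto
  hence "(\<lambda>k. norm (f k)) summable_on - B"
    using B(2) by (rule Infinite_Sum.abs_summable_on_comparison_test') auto
  from summable_on_union[OF summable_on_finite[OF B(1)] this] show ?thesis by simp
qed

lemma filterlim_symmetric_intervals:
  "filterlim (\<lambda>m. {- int m..<int m}) (finite_subsets_at_top UNIV) sequentially"
  unfolding filterlim_finite_subsets_at_top
proof safe
  fix X :: "int set" assume "finite X"
  \<comment> \<open>The sum dominates every single absolute value; \<open>Suc\<close> makes the
    bound strict, as the excluded upper endpoint requires.\<close>
  define b where "b = Suc (\<Sum>x\<in>X. nat \<bar>x\<bar>)"
  have "\<bar>x\<bar> < int b" if "x \<in> X" for x
    using member_le_sum[of x X "\<lambda>x. nat \<bar>x\<bar>"] \<open>finite X\<close> that unfolding b_def by linarith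
  hence "X \<subseteq> {- int m..<int m}" if "m \<ge> b" for m
    using that by (force simp: abs_less_iff)
  thus "\<forall>\<^sub>F m in sequentially. finite {- int m..<int m} \<and> X \<subseteq> {- int m..<int m} \<and> {- int m..<int m} \<subseteq> UNIV"
    by (auto simp: eventually_sequentially)
qed

text \<open>Symmetric intervals eventually contain every finite set of integers, so for an
  absolutely summable family their partial sums determine the sum. Partial fraction expansions that
  converge only in this symmetric sense thereby become usable.\<close>

lemma infsum_int_eqI:
  fixes f :: "int \<Rightarrow> complex"
  assumes "(\<lambda>k. norm (f k)) summable_on UNIV"
    and "(\<lambda>m. \<Sum>k = - int m..<int m. f k) \<longlonglongrightarrow> S"
  shows "infsum f UNIV = S"
proof -
  have "f summable_on UNIV" using assms(1) by (rule abs_summable_summable)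
  hence "(sum f \<longlongrightarrow> infsum f UNIV) (finite_subsets_at_top UNIV)"
    unfolding has_sum_def[symmetric] by (rule has_sum_infsum)
  from filterlim_compose[OF this filterlim_symmetric_intervals] assms(2)
  show ?thesis by (rule LIMSEQ_unique)
qed

lemma sum_symmetric_interval_Suc:
  fixes f :: "int \<Rightarrow> 'a :: comm_monoid_add"
  shows "(\<Sum>k = - int (Suc m)..<int (Suc m). f k) =
    f (int m) + f (- int (Suc m)) + (\<Sum>k = - int m..<int m. f k)"
proof -
  have "{- int (Suc m)..<int (Suc m)} = insert (int m) (insert (- int (Suc m)) {- int m..<int m})"
    by auto
  thus ?thesis by (simp add: add_ac)
qed

lemma filterlim_inj_cofinite:
  fixes f :: "'a \<Rightarrow> 'b"
  assumes "inj f"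
  shows "filterlim f cofinite cofinite"
  unfolding filterlim_iff eventually_cofinite
proof safe
  fix P :: "'b \<Rightarrow> bool" assume "finite {x. \<not> P x}"
  from finite_vimageI[OF this assms] show "finite {x. \<not> P (f x)}"
    by (simp add: vimage_def)
qed

text \<open>The symmetric partial sums collapse to \<open>T m - T (- m)\<close>. Both endpoints
  leave every finite set, so both values tend to the same \<open>L\<close>.\<close>

lemma infsum_int_telescope:
  fixes f T :: "int \<Rightarrow> complex"
  assumes "(\<lambda>k. norm (f k)) summable_on UNIV"
    and T: "\<And>k. f k = T (k + 1) - T k" and lim: "(T \<longlongrightarrow> L) cofinite"
  shows "infsum f UNIV = 0"
proof (rule infsum_int_eqI[OF assms(1)])
  have "(\<Sum>k = - int m..<int m. f k) = T (int m) - T (- int m)" for m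
    by (induction m) (simp_all only: sum_symmetric_interval_Suc T, simp_all add: algebra_simps)
  moreover have "filterlim int cofinite sequentially" "filterlim (\<lambda>m. - int m) cofinite sequentially"
    unfolding cofinite_eq_sequentially[symmetric]
    by (auto intro!: filterlim_inj_cofinite simp: inj_on_def)
  hence "(\<lambda>m. T (int m) - T (- int m)) \<longlonglongrightarrow> L - L"
    by (intro tendsto_diff filterlim_compose[OF lim])
  ultimately show "(\<lambda>m. \<Sum>k = - int m..<int m. f k) \<longlonglongrightarrow> 0" by simp
qed

section \<open>Reflection formulas and partial fractions of the cotangent\<close>

lemma not_Ints_imp_not_nonpos_Ints:
  fixes z :: complex
  assumes "z \<notin> \<int>"
  shows "z \<notin> \<int>\<^sub>\<le>\<^sub>0" "1 - z \<notin> \<int>\<^sub>\<le>\<^sub>0" "z \<noteq> 0" "1 - z \<noteq> 0"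
proof -
  have *: "1 - z \<notin> \<int>"
  proof
    assume "1 - z \<in> \<int>"
    hence "1 - (1 - z) \<in> \<int>" by (intro Ints_diff) auto
    thus False using assms by simp
  qed
  show "z \<notin> \<int>\<^sub>\<le>\<^sub>0" "1 - z \<notin> \<int>\<^sub>\<le>\<^sub>0" using assms * nonpos_Ints_Int by blast+
  show "z \<noteq> 0" "1 - z \<noteq> 0" using assms * by (metis Ints_0)+
qed

lemma sin_pi_times_nonzero:
  fixes z :: complex
  assumes "z \<notin> \<int>"
  shows "sin (of_real pi * z) \<noteq> 0"
  using rGamma_reflection_complex[of z] not_Ints_imp_not_nonpos_Ints[OF assms]
  by (auto simp: rGamma_eq_zero_iff)

text \<open>Logarithmic differentiation of
  \<open>rGamma z * rGamma (1 - z) = sin (pi * z) / pi\<close>: the derivatives of both sides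
  agree.\<close>

lemma Digamma_reflection:
  fixes z :: complex
  assumes "z \<notin> \<int>"
  shows "Digamma (1 - z) - Digamma z = of_real pi * cot (of_real pi * z)"
proof -
  note nz = not_Ints_imp_not_nonpos_Ints[OF assms] sin_pi_times_nonzero[OF assms]
  have "((\<lambda>z. rGamma z * rGamma (1 - z)) has_field_derivative
      (rGamma z * rGamma (1 - z)) * (Digamma (1 - z) - Digamma z)) (at z)"
    using nz by (auto intro!: derivative_eq_intros simp: algebra_simps)
  moreover have "((\<lambda>z. sin (of_real pi * z) / of_real pi) has_field_derivative cos (of_real pi * z)) (at z)"
    by (auto intro!: derivative_eq_intros)
  ultimately have "(rGamma z * rGamma (1 - z)) * (Digamma (1 - z) - Digamma z) = cos (of_real pi * z)"
    unfolding rGamma_reflection_complex by (rule DERIV_unique)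
  thus ?thesis
    using nz by (simp add: rGamma_reflection_complex cot_def field_simps)
qed

text \<open>The half-open interval gives both halves exactly \<open>m\<close> terms. The indices
  \<open>- (n + 1)\<close> of the negative half turn \<open>z + k\<close> into
  \<open>- (1 - z + n)\<close>, so that half becomes a series at \<open>1 - z\<close>.\<close>

lemma sum_symmetric_interval_split:
  fixes f :: "int \<Rightarrow> complex"
  shows "(\<Sum>k = - int m..<int m. f k) = (\<Sum>n<m. f (int n)) + (\<Sum>n<m. f (- int (Suc n)))"
  by (induction m) (simp_all add: sum_symmetric_interval_Suc add_ac del: of_nat_Suc)

text \<open>Each half of the sum diverges logarithmically. Inserting \<open>ln m\<close> into both
  turns them into the limits defining \<open>Digamma\<close> at \<open>1 - z\<close> and
  \<open>z\<close>, whose difference is given by reflection.\<close>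

lemma cot_partial_fractions:
  fixes z :: complex
  assumes "z \<notin> \<int>"
  shows "(\<lambda>m. \<Sum>k = - int m..<int m. 1 / (z + of_int k)) \<longlonglongrightarrow> of_real pi * cot (of_real pi * z)"
proof -
  note nz = not_Ints_imp_not_nonpos_Ints[OF assms]
  have "1 / (z + of_int (- int (Suc n))) = - inverse (1 - z + of_nat n)" for n
  proof -
    have "z + of_int (- int (Suc n)) = - (1 - z + of_nat n)" by simp
    thus ?thesis by (metis inverse_eq_divide inverse_minus_eq)
  qed
  hence "(\<Sum>k = - int m..<int m. 1 / (z + of_int k)) =
      (of_real (ln (real m)) - (\<Sum>n<m. inverse (1 - z + of_nat n))) -
      (of_real (ln (real m)) - (\<Sum>n<m. inverse (z + of_nat n)))" for m
    by (simp add: sum_symmetric_interval_split sum_negf inverse_eq_divide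
             del: of_int_minus of_nat_Suc)
  thus ?thesis
    using tendsto_diff[OF Digamma_LIMSEQ[OF nz(4)] Digamma_LIMSEQ[OF nz(3)]]
    by (simp add: Digamma_reflection[OF assms])
qed

text \<open>Differentiating the reflection formula for \<open>Digamma\<close> on the open complement
  of the integers yields \<open>Polygamma 1 z + Polygamma 1 (1 - z)\<close>, and the two halves of
  the sum are the series of these two values.\<close>

lemma csc_squared_partial_fractions:
  fixes z :: complex
  assumes "z \<notin> \<int>"
  shows "(\<lambda>m. \<Sum>k = - int m..<int m. 1 / (z + of_int k)\<^sup>2) \<longlonglongrightarrow> (of_real pi / sin (of_real pi * z))\<^sup>2"
proof -
  note nz = not_Ints_imp_not_nonpos_Ints[OF assms] sin_pi_times_nonzero[OF assms]
  have "((\<lambda>z. Digamma (1 - z) - Digamma z) has_field_derivative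
      - Polygamma 1 (1 - z) - Polygamma 1 z) (at z)"
    using nz by (auto intro!: derivative_eq_intros)
  hence "((\<lambda>z. of_real pi * cot (of_real pi * z)) has_field_derivative
      - Polygamma 1 (1 - z) - Polygamma 1 z) (at z)"
    by (rule has_field_derivative_transform_within_open[where S = "- \<int>"])
       (use assms Digamma_reflection in \<open>auto simp: closed_Ints\<close>)
  moreover have "((\<lambda>z. of_real pi * cot (of_real pi * z)) has_field_derivative
      - (of_real pi / sin (of_real pi * z))\<^sup>2) (at z)"
    using nz by (auto intro!: derivative_eq_intros DERIV_chain2[OF DERIV_cot]
        simp: power2_eq_square field_simps)
  ultimately have "- Polygamma 1 (1 - z) - Polygamma 1 z = - (of_real pi / sin (of_real pi * z))\<^sup>2"
    by (rule DERIV_unique)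
  hence eq: "Polygamma 1 z + Polygamma 1 (1 - z) = (of_real pi / sin (of_real pi * z))\<^sup>2"
    by (metis add.commute minus_add_distrib minus_minus uminus_add_conv_diff diff_conv_add_uminus)
  have "1 / (z + of_int (- int (Suc n)))\<^sup>2 = inverse ((1 - z + of_nat n)\<^sup>2)" for n
  proof -
    have "z + of_int (- int (Suc n)) = - (1 - z + of_nat n)" by simp
    thus ?thesis by (metis inverse_eq_divide power2_minus)
  qed
  hence "(\<Sum>k = - int m..<int m. 1 / (z + of_int k)\<^sup>2) =
      (\<Sum>n<m. inverse ((z + of_nat n)\<^sup>2)) + (\<Sum>n<m. inverse ((1 - z + of_nat n)\<^sup>2))" for m
    by (simp add: sum_symmetric_interval_split inverse_eq_divide del: of_int_minus of_nat_Suc)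
  moreover have "(\<lambda>m. \<Sum>n<m. inverse ((w + of_nat n)\<^sup>2)) \<longlonglongrightarrow> Polygamma 1 w" if "w \<noteq> 0" for w :: complex
    using Polygamma_LIMSEQ[OF that, of 1] by (simp add: sums_def numeral_2_eq_2)
  ultimately show ?thesis
    unfolding eq[symmetric] using nz(3,4) by (simp only: tendsto_add not_False_eq_True)
qed

section \<open>Bilateral sums of the rational summands\<close>

lemma tendsto_pochhammer_ratio_cofinite:
  fixes z w :: complex
  assumes "z \<notin> \<int>"
  shows "((\<lambda>k::int. pochhammer (w + of_int k) n / pochhammer (z + of_int k) n) \<longlongrightarrow> 1) cofinite"
proof -
  have "((\<lambda>k::int. (w + of_int k + of_nat j) / (z + of_int k + of_nat j)) \<longlongrightarrow> 1) cofinite" for j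
    using tendsto_ratio_cofinite[of "z + of_nat j" "w + of_nat j"] assms by (simp add: add_ac)
  hence "((\<lambda>k::int. \<Prod>j = 0..<n. (w + of_int k + of_nat j) / (z + of_int k + of_nat j)) \<longlongrightarrow> (\<Prod>j = 0..<n. 1)) cofinite"
    by (intro tendsto_prod)
  thus ?thesis by (simp add: pochhammer_prod prod_dividef)
qed

lemma pochhammer_shift_nonzero:
  fixes z :: complex
  assumes "z \<notin> \<int>"
  shows "pochhammer (z + of_int k) n \<noteq> 0"
  using add_of_int_nonzero[OF assms, of "k + int j" for j]
  by (auto simp: pochhammer_prod add_ac)

lemma pochhammer_Suc_Suc:
  fixes z :: complex
  shows "pochhammer z (Suc (Suc m)) = z * pochhammer (z + 1) m * (z + of_nat (Suc m))"
  by (simp only: pochhammer_rec[of z] pochhammer_Suc[of _ m]) (simp add: add_ac)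

lemma inverse_product_bilateral_sum:
  fixes a c :: complex
  assumes a: "a \<notin> \<int>" and c: "c \<notin> \<int>"
  defines "f \<equiv> (\<lambda>k::int. 1 / ((a + of_int k) * (c + of_int k)))"
  shows "(\<lambda>k. norm (f k)) summable_on UNIV"
    and "infsum f UNIV = (of_real pi)\<^sup>2 * (rGamma (1 + a - c) * rGamma (1 + c - a)) /
      (sin (of_real pi * a) * sin (of_real pi * c))"
proof -
  \<comment> \<open>The numerators are written \<open>0 + of_int k\<close> to match the ratio limit;
    the product is \<open>k^2 * f k\<close>.\<close>
  have "((\<lambda>k::int. (0 + of_int k) / (a + of_int k) * ((0 + of_int k) / (c + of_int k))) \<longlongrightarrow> 1 * 1) cofinite"
    by (intro tendsto_mult tendsto_ratio_cofinite a c)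
  hence "((\<lambda>k. (of_int k)\<^sup>2 * f k) \<longlongrightarrow> 1) cofinite"
    by (simp add: f_def power2_eq_square)
  thus summable: "(\<lambda>k. norm (f k)) summable_on UNIV"
    by (rule abs_summable_on_int_quadratic_decay)
  note sin_nz = sin_pi_times_nonzero[OF a] sin_pi_times_nonzero[OF c]
  show "infsum f UNIV = (of_real pi)\<^sup>2 * (rGamma (1 + a - c) * rGamma (1 + c - a)) /
      (sin (of_real pi * a) * sin (of_real pi * c))"
  proof (cases "a = c")
    case True
    have "infsum f UNIV = (of_real pi / sin (of_real pi * a))\<^sup>2"
      using summable csc_squared_partial_fractions[OF a] True
      by (intro infsum_int_eqI) (simp_all add: f_def power2_eq_square)
    thus ?thesis using True by (simp add: power2_eq_square)
  next
    case False
    have f: "f k = (1 / (a + of_int k) - 1 / (c + of_int k)) / (c - a)" for k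
      using False add_of_int_nonzero[OF a, of k] add_of_int_nonzero[OF c, of k]
      by (simp add: f_def divide_simps)
    have "(\<lambda>m. ((\<Sum>k = - int m..<int m. 1 / (a + of_int k)) - (\<Sum>k = - int m..<int m. 1 / (c + of_int k))) / (c - a))
        \<longlonglongrightarrow> (of_real pi * cot (of_real pi * a) - of_real pi * cot (of_real pi * c)) / (c - a)"
      using False by (intro tendsto_intros cot_partial_fractions a c) auto
    hence "infsum f UNIV = (of_real pi * cot (of_real pi * a) - of_real pi * cot (of_real pi * c)) / (c - a)"
      by (intro infsum_int_eqI summable)
         (simp add: f sum_subtractf flip: sum_divide_distrib)
    also have "\<dots> = of_real pi * sin (of_real pi * (c - a)) /
        ((c - a) * (sin (of_real pi * a) * sin (of_real pi * c)))"
      using sin_nz False by (simp add: cot_def sin_diff right_diff_distrib divide_simps) (simp add: algebra_simps)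
    \<comment> \<open>Reflection combined with \<open>rGamma d = d * rGamma (1 + d)\<close>. Taking
      \<open>d = c - a\<close> converts the sine from the difference of cotangents into the two
      reciprocal Gamma factors.\<close>
    also have "rGamma (1 + d) * rGamma (1 - d) = sin (of_real pi * d) / (of_real pi * d)" if "d \<noteq> 0" for d :: complex
      using rGamma_plus1[of d, symmetric] rGamma_reflection_complex[of d] that
      by (simp add: field_simps)
    from this[of "c - a"] False have "of_real pi * sin (of_real pi * (c - a)) / ((c - a) * (sin (of_real pi * a) * sin (of_real pi * c))) =
      (of_real pi)\<^sup>2 * (rGamma (1 + a - c) * rGamma (1 + c - a)) / (sin (of_real pi * a) * sin (of_real pi * c))"
      using sin_nz False
      by (simp add: add_diff_eq diff_diff_eq2 power2_eq_square divide_simps del: mult_eq_0_iff)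
         (simp add: mult_ac)
    finally show ?thesis .
  qed
qed

lemma pochhammer_ratio_bilateral_sum:
  fixes a c :: complex and m :: nat
  assumes a: "a \<notin> \<int>"
  defines "f \<equiv> (\<lambda>k::int. pochhammer (c + of_int k + 1) m / pochhammer (a + of_int k) (Suc (Suc m)))"
  shows "(\<lambda>k. norm (f k)) summable_on UNIV"
    and "infsum f UNIV = 0"
proof -
  note nz = pochhammer_shift_nonzero[OF a]
  \<comment> \<open>The denominator has two factors more than the numerator, its first and its last;
    each is paired with one \<open>k\<close> from \<open>k^2\<close>.\<close>
  have "((\<lambda>k::int. pochhammer ((c + 1) + of_int k) m / pochhammer ((a + 1) + of_int k) m *
      ((0 + of_int k) / (a + of_int k) * ((0 + of_int k) / ((a + of_nat (Suc m)) + of_int k)))) \<longlongrightarrow> 1 * (1 * 1)) cofinite"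
    using a by (intro tendsto_mult tendsto_ratio_cofinite tendsto_pochhammer_ratio_cofinite) auto
  moreover have "pochhammer (a + of_int k) (Suc (Suc m)) =
      (a + of_int k) * pochhammer ((a + 1) + of_int k) m * ((a + of_nat (Suc m)) + of_int k)" for k
    by (simp only: pochhammer_Suc_Suc) (simp add: add_ac)
  ultimately have "((\<lambda>k. (of_int k)\<^sup>2 * f k) \<longlongrightarrow> 1) cofinite"
    by (simp add: f_def power2_eq_square mult_ac add_ac del: pochhammer_Suc)
  thus summable: "(\<lambda>k. norm (f k)) summable_on UNIV"
    by (rule abs_summable_on_int_quadratic_decay)
  show "infsum f UNIV = 0"
  proof (cases "a = c")
    case True
    \<comment> \<open>This is the limit for \<open>c\<close> tending to \<open>a\<close> of the
      \<open>T\<close> used when \<open>a \<noteq> c\<close>, after its limiting value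
      \<open>1 / ((m + 1) * (a - c))\<close> is subtracted.\<close>
    define T where "T = (\<lambda>k::int. - (\<Sum>j<Suc m. 1 / ((a + of_nat j) + of_int k)) / of_nat (Suc m))"
    show ?thesis
    proof (rule infsum_int_telescope[OF summable])
      have "(T \<longlongrightarrow> - (\<Sum>j<Suc m. 0) / of_nat (Suc m)) cofinite"
        unfolding T_def by (intro tendsto_intros tendsto_inverse_shift_cofinite of_nat_neq_0)
      thus "(T \<longlongrightarrow> 0) cofinite" by simp
      fix k
      have nz1: "a + of_int k \<noteq> 0" "a + of_int k + of_nat (Suc m) \<noteq> 0"
        using add_of_int_nonzero[OF a, of k] add_of_int_nonzero[OF a, of "k + int (Suc m)"]
        by (simp_all add: add_ac)
      have nz2: "pochhammer (a + of_int k + 1) m \<noteq> 0"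
        using nz[of "k + 1" m] by (simp add: add_ac)
      have f: "f k = 1 / ((a + of_int k) * (a + of_int k + of_nat (Suc m)))"
        using nz2 True unfolding f_def pochhammer_Suc_Suc by (simp del: of_nat_Suc pochhammer_Suc)
      have "T (k + 1) = - (\<Sum>j<Suc m. 1 / (a + of_int k + of_nat (Suc j))) / of_nat (Suc m)"
           "T k = - (\<Sum>j<Suc m. 1 / (a + of_int k + of_nat j)) / of_nat (Suc m)"
        by (simp_all add: T_def add_ac del: sum.lessThan_Suc)
      hence "T (k + 1) - T k = ((\<Sum>j<Suc m. 1 / (a + of_int k + of_nat j)) -
          (\<Sum>j<Suc m. 1 / (a + of_int k + of_nat (Suc j)))) / of_nat (Suc m)"
        by (simp add: diff_divide_distrib del: sum.lessThan_Suc of_nat_Suc)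
      also have "\<dots> = (1 / (a + of_int k) - 1 / (a + of_int k + of_nat (Suc m))) / of_nat (Suc m)"
        using sum_lessThan_telescope'[of "\<lambda>j. 1 / (a + of_int k + of_nat j)" "Suc m"]
        by (simp only: sum_subtractf of_nat_0 add_0_right)
      also have "\<dots> = f k"
        using nz1 by (simp add: f divide_simps del: of_nat_Suc)
      finally show "f k = T (k + 1) - T k" ..
    qed
  next
    case False
    define T where "T = (\<lambda>k::int. pochhammer (c + of_int k) (Suc m) / pochhammer (a + of_int k) (Suc m) /
      (of_nat (Suc m) * (a - c)))"
    show ?thesis
    proof (rule infsum_int_telescope[OF summable])
      show "(T \<longlongrightarrow> 1 / (of_nat (Suc m) * (a - c))) cofinite"
        unfolding T_def using False
        by (intro tendsto_divide tendsto_pochhammer_ratio_cofinite[OF a] tendsto_const)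
           (simp del: of_nat_Suc)
      fix k
      define x y where "x = a + of_int k" and "y = c + of_int k"
      have nz1: "x \<noteq> 0" "x + of_nat (Suc m) \<noteq> 0"
        using add_of_int_nonzero[OF a, of k] add_of_int_nonzero[OF a, of "k + int (Suc m)"]
        by (simp_all add: add_ac x_def)
      have nz2: "pochhammer (x + 1) m \<noteq> 0"
        using nz[of "k + 1" m] by (simp add: add_ac x_def)
      have last: "pochhammer (z + 1) (Suc m) = pochhammer (z + 1) m * (z + of_nat (Suc m))" for z :: complex
        by (simp add: pochhammer_Suc add_ac)
      note expand = pochhammer_Suc_Suc[of x m] pochhammer_rec[of x m] pochhammer_rec[of y m] last
      have xy: "a - c = x - y" "x - y \<noteq> 0" using False by (simp_all add: x_def y_def)
      have "T (k + 1) - T k = (pochhammer (y + 1) (Suc m) / pochhammer (x + 1) (Suc m) -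
          pochhammer y (Suc m) / pochhammer x (Suc m)) / (of_nat (Suc m) * (x - y))"
        by (simp only: T_def xy diff_divide_distrib) (simp add: x_def y_def add_ac)
      \<comment> \<open>After the common factors are extracted, this is the identity
        \<open>x * (y + m + 1) - y * (x + m + 1) = (m + 1) * (x - y)\<close>.\<close>
      also have "pochhammer (y + 1) (Suc m) / pochhammer (x + 1) (Suc m) - pochhammer y (Suc m) / pochhammer x (Suc m) =
         pochhammer (y + 1) m * (of_nat (Suc m) * (x - y)) / pochhammer x (Suc (Suc m))"
        unfolding expand using nz1 nz2 by (simp add: divide_simps del: of_nat_Suc) (simp add: algebra_simps del: of_nat_Suc)
      also have "\<dots> / (of_nat (Suc m) * (x - y)) = f k"
        using xy(2) unfolding f_def x_def[symmetric] y_def[symmetric] by (simp del: of_nat_Suc pochhammer_Suc)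
      finally show "f k = T (k + 1) - T k" ..
    qed
  qed
qed

section \<open>From reciprocal Gamma functions to rational functions\<close>

text \<open>The recurrence lowers the argument \<open>1 + x + n\<close> to \<open>x\<close> at the
  cost of \<open>n + 1\<close> linear factors, after which reflection at \<open>x\<close>
  applies.\<close>

lemma rGamma_pair_eq_inverse_pochhammer:
  fixes x :: complex
  assumes "pochhammer x (Suc n) \<noteq> 0"
  shows "rGamma (1 + x + of_nat n) * rGamma (1 - x) =
    sin (of_real pi * x) / (of_real pi * pochhammer x (Suc n))"
  using assms rGamma_reflection_complex[of x] pochhammer_rGamma[of x "Suc n"]
  by (simp add: field_simps del: pochhammer_Suc)

text \<open>Here the argument \<open>1 + y\<close> is raised to \<open>y + m + 1\<close>, where
  reflection applies. Only \<open>m\<close> factors arise, and shifting the sine by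
  \<open>m + 1\<close> half-periods produces the sign.\<close>

lemma rGamma_pair_eq_pochhammer:
  fixes y :: complex
  shows "rGamma (1 + y) * rGamma (1 - y - of_nat (Suc m)) =
    (- 1) ^ Suc m * sin (of_real pi * y) / of_real pi * pochhammer (y + 1) m"
proof -
  have "cos (of_real pi * of_nat n :: complex) = (- 1) ^ n"
       "sin (of_real pi * of_nat n :: complex) = 0" for n
    using cos_of_real[of "pi * real n", where 'a = complex] sin_of_real[of "pi * real n", where 'a = complex]
    by simp_all
  hence "sin (of_real pi * (y + of_nat n)) = (- 1) ^ n * sin (of_real pi * y)" for n
    by (simp add: sin_add distrib_left)
  moreover have "rGamma (1 + y) = pochhammer (y + 1) m * rGamma (y + of_nat (Suc m))"
    using pochhammer_rGamma[of "y + 1" m] by (simp add: add_ac)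
  ultimately show ?thesis
    using rGamma_reflection_complex[of "y + of_nat (Suc m)"]
    by (simp add: diff_diff_eq mult_ac del: of_nat_Suc power_Suc)
qed

text \<open>Each sine acquires the factor \<open>cos (pi * k)\<close>, whose square is 1. Hence the
  sines can be taken out of the sum over \<open>k\<close>.\<close>

lemma sin_pi_shift_product:
  fixes a c :: complex
  shows "sin (of_real pi * (a + of_int k)) * sin (of_real pi * (c + of_int k)) =
    sin (of_real pi * a) * sin (of_real pi * c)"
proof -
  have s: "sin (of_real pi * of_int k :: complex) = 0"
    using sin_of_real[of "pi * real_of_int k", where 'a = complex] by simp
  hence "cos (of_real pi * of_int k :: complex) * cos (of_real pi * of_int k) = 1"
    using sin_cos_squared_add[of "of_real pi * of_int k :: complex"] by (simp add: power2_eq_square)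
  thus ?thesis using s by (simp add: sin_add distrib_left mult_ac)
qed

lemma rGamma_bilateral_sum_nat:
  fixes a c :: complex and n :: nat
  assumes a: "a \<notin> \<int>" and c: "c \<notin> \<int>"
  defines "f \<equiv> (\<lambda>k::int. rGamma (1 + a + of_nat n + of_int k) * rGamma (1 - c - of_nat n - of_int k) *
      (rGamma (1 + c + of_int k) * rGamma (1 - a - of_int k)))"
  shows "(\<lambda>k. norm (f k)) summable_on UNIV \<and>
    infsum f UNIV = (if n = 0 then rGamma (1 + a - c) * rGamma (1 + c - a) else 0)"
proof -
  \<comment> \<open>Up to sign, \<open>K\<close> is the factor between the Gamma summand and the
    rational one. For \<open>n = 0\<close> it cancels the sines and powers of pi in the sum of
    \<open>1 / (x * y)\<close>.\<close>
  define K where "K = sin (of_real pi * a) * sin (of_real pi * c) / (of_real pi)\<^sup>2"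
  have f: "f k = (rGamma (1 + (a + of_int k) + of_nat n) * rGamma (1 - (a + of_int k))) *
      (rGamma (1 + (c + of_int k)) * rGamma (1 - (c + of_int k) - of_nat n))" for k
    by (simp add: f_def algebra_simps)
  have K: "K = sin (of_real pi * (a + of_int k)) * sin (of_real pi * (c + of_int k)) / (of_real pi)\<^sup>2" for k
    by (simp add: K_def sin_pi_shift_product)
  note nz = pochhammer_shift_nonzero[OF a]
  show ?thesis
  proof (cases n)
    case 0
    have "f k = K * (1 / ((a + of_int k) * (c + of_int k)))" for k
      using rGamma_pair_eq_inverse_pochhammer[of "a + of_int k" 0] nz[of k 1]
        rGamma_pair_eq_inverse_pochhammer[of "c + of_int k" 0] pochhammer_shift_nonzero[OF c, of k 1]
      unfolding f 0 K[of k] by (simp add: power2_eq_square)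
    hence f': "f = (\<lambda>k. K * (1 / ((a + of_int k) * (c + of_int k))))" by blast
    have "K \<noteq> 0" using sin_pi_times_nonzero[OF a] sin_pi_times_nonzero[OF c] by (simp add: K_def)
    show ?thesis
      unfolding f' norm_mult[of K] infsum_cmult_right'
      using inverse_product_bilateral_sum[OF a c] \<open>K \<noteq> 0\<close> 0
      by (auto intro!: summable_on_cmult_right simp: K_def)
  next
    case (Suc m)
    have "f k = (- 1) ^ Suc m * K * (pochhammer (c + of_int k + 1) m / pochhammer (a + of_int k) (Suc (Suc m)))" for k
      unfolding f Suc rGamma_pair_eq_inverse_pochhammer[OF nz] rGamma_pair_eq_pochhammer K[of k]
      by (simp add: power2_eq_square mult_ac del: pochhammer_Suc)
    hence f': "f = (\<lambda>k. (- 1) ^ Suc m * K * (pochhammer (c + of_int k + 1) m / pochhammer (a + of_int k) (Suc (Suc m))))"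
      by blast
    show ?thesis
      unfolding f' norm_mult[of "(- 1) ^ Suc m * K"] infsum_cmult_right'
      using pochhammer_ratio_bilateral_sum[OF a, of c m] Suc
      by (auto intro!: summable_on_cmult_right)
  qed
qed

text \<open>The smaller of the two indices is absorbed into both parameters, leaving a natural
  number as the offset. If \<open>n < l\<close>, the two pairs of factors trade places, which
  exchanges \<open>a\<close> and \<open>c\<close>.\<close>

lemma rGamma_bilateral_sum:
  fixes a c :: complex
  assumes a: "a \<notin> \<int>" and c: "c \<notin> \<int>"
  defines "f \<equiv> (\<lambda>n l k::int. rGamma (1 + a + of_int n + of_int k) * rGamma (1 - c - of_int n - of_int k) *
      (rGamma (1 + c + of_int l + of_int k) * rGamma (1 - a - of_int l - of_int k)))"
  shows "(\<lambda>k. norm (f n l k)) summable_on UNIV \<and>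
    infsum (f n l) UNIV = (if n = l then rGamma (1 + a - c) * rGamma (1 + c - a) else 0)"
proof (cases "l \<le> n")
  case True
  define N where "N = nat (n - l)"
  have n: "of_int n = of_int l + (of_nat N :: complex)" and N: "N = 0 \<longleftrightarrow> n = l"
    using True unfolding N_def by (auto simp: algebra_simps)
  show ?thesis
    using rGamma_bilateral_sum_nat[of "a + of_int l" "c + of_int l" N] a c
    by (simp add: f_def n N algebra_simps)
next
  case False
  define N where "N = nat (l - n)"
  have l: "of_int l = of_int n + (of_nat N :: complex)" and N: "N \<noteq> 0"
    using False unfolding N_def by (auto simp: algebra_simps)
  show ?thesis
    using rGamma_bilateral_sum_nat[of "c + of_int n" "a + of_int n" N] a c False N
    by (simp add: f_def l algebra_simps)
qed

section \<open>The two matrix products\<close>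

lemma has_matrix_product_Gamma:
  fixes a c :: complex
  assumes a: "a \<notin> \<int>" and c: "c \<notin> \<int>" and ac: "a - c \<notin> \<int> - {0}"
  shows "has_matrix_product
    (\<lambda>n k. Gamma (1 + a - c) /
       (Gamma (1 + a + of_int n + of_int k) * Gamma (1 - c - of_int n - of_int k)))
    (\<lambda>k l. Gamma (1 + c - a) /
       (Gamma (1 + c + of_int l + of_int k) * Gamma (1 - a - of_int l - of_int k)))
    (\<lambda>n l. if n = l then 1 else 0)"
proof -
  define C where "C = Gamma (1 + a - c) * Gamma (1 + c - a)"
  have *: "1 + z \<notin> \<int>\<^sub>\<le>\<^sub>0" if "z \<notin> \<int> - {0}" for z :: complex
  proof (cases "z = 0")
    case False
    hence "1 + z \<notin> \<int>" using that by simp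
    thus ?thesis using nonpos_Ints_Int by blast
  qed auto
  have "c - a \<notin> \<int> - {0}" using ac minus_in_Ints_iff[of "a - c"] by auto
  \<comment> \<open>Neither \<open>1 + a - c\<close> nor \<open>1 + c - a\<close> is a pole of
    Gamma, so \<open>C\<close>, the product of the two numerators, is the reciprocal of the diagonal
    sum.\<close>
  hence C: "C * (rGamma (1 + a - c) * rGamma (1 + c - a)) = 1"
    using *[of "a - c"] *[of "c - a"] ac
    by (simp add: C_def rGamma_inverse_Gamma Gamma_eq_zero_iff field_simps)
  let ?f = "\<lambda>n l k::int. rGamma (1 + a + of_int n + of_int k) * rGamma (1 - c - of_int n - of_int k) *
      (rGamma (1 + c + of_int l + of_int k) * rGamma (1 - a - of_int l - of_int k))"
  have "Gamma (1 + a - c) / (Gamma (1 + a + of_int n + of_int k) * Gamma (1 - c - of_int n - of_int k)) *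
      (Gamma (1 + c - a) / (Gamma (1 + c + of_int l + of_int k) * Gamma (1 - a - of_int l - of_int k))) =
      C * ?f n l k" for n l k
    by (simp add: C_def rGamma_inverse_Gamma divide_inverse)
  thus ?thesis
    using rGamma_bilateral_sum[OF a c] C
    by (auto simp: has_matrix_product_def norm_mult[of C] infsum_cmult_right' intro!: summable_on_cmult_right)
qed

theorem theorem2:
  fixes a c :: complex
  assumes "a \<notin> \<int>" and "c \<notin> \<int>" and "a - c \<notin> \<int> - {0}"
  shows "inverse_matrices
    (\<lambda>n k. Gamma (1 + a - c) /
       (Gamma (1 + a + of_int n + of_int k) * Gamma (1 - c - of_int n - of_int k)))
    (\<lambda>k l. Gamma (1 + c - a) /
       (Gamma (1 + c + of_int l + of_int k) * Gamma (1 - a - of_int l - of_int k)))"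
proof -
  have "c - a \<notin> \<int> - {0}" using assms(3) minus_in_Ints_iff[of "a - c"] by auto
  \<comment> \<open>The entries depend only on the sum of row and column index, so both matrices are
    symmetric. The second product is then the first with \<open>a\<close> and \<open>c\<close>
    exchanged.\<close>
  have swap: "1 + w + of_int k + of_int n = 1 + w + of_int n + of_int k"
    "1 - w - of_int k - of_int n = 1 - w - of_int n - of_int k" for w :: complex and n k :: int
    by simp_all
  show ?thesis
    unfolding inverse_matrices_def
    using has_matrix_product_Gamma[OF assms]
      has_matrix_product_Gamma[OF assms(2,1) \<open>c - a \<notin> \<int> - {0}\<close>]
    by (simp only: swap)
qed

end
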